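(* Let $n\ge 1$ and let $R\in\mathbb{S}^{n+1}$. Let $\widetilde z=(\widetilde z_0,\dots,\widetilde z_n)^T\in\{-1,1\}^{n+1}$, with $\widetilde z_0=1$, be the correct solution of $$\min_{z\in\{-1,1\}^{n+1}} z^TRz ,$$ that is, the unique minimizer among the vectors $z\in\{-1,1\}^{n+1}$ with $z_0=1$. Assume that the matrix $\widetilde z\widetilde z^T$ is among the global minimizers of the semidefinite relaxation $$\min_{Z\in\mathbb{S}_+^{n+1}} \langle R,Z\rangle\quad\text{s.t. } Z_{i,i}=1,\ i=0,\dots,n .$$ Then, for any $\lambda>0$, the problem $$\min_{Z\in\mathbb{S}_+^{n+1}} \langle R,Z\rangle-\lambda\langle Z,Z\rangle\quad\text{s.t. } Z_{i,i}=1,\ i=0,\dots,n$$ has as its (unique) global minimizer $Z^\star=\widetilde z\widetilde z^T$. Moreover, $\widetilde z=(1,Z^\star_{1,0},\dots,Z^\star_{n,0})^T$.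
   Context: $\mathbb{S}^{n+1}$ is the space of real symmetric $(n+1)\times(n+1)$ matrices and $\mathbb{S}_+^{n+1}\subset\mathbb{S}^{n+1}$ the subset of positive semidefinite ones; rows, columns and vector entries are indexed by $0,\dots,n$. $\langle A,B\rangle=\mathrm{tr}(A^TB)$ is the Frobenius inner product. The index-$0$ entry of $z$ is a homogenizing slack variable, equal to $1$ for the correct solution. *)

theory Defs
  imports Complex_Main "Jordan_Normal_Form.Matrix"
begin

definition sym_mats :: "nat \<Rightarrow> real mat set" where
  "sym_mats m = {A \<in> carrier_mat m m. transpose_mat A = A}"

definition psd_mats :: "nat \<Rightarrow> real mat set" where
  "psd_mats m = {A \<in> sym_mats m. \<forall>v \<in> carrier_vec m. 0 \<le> v \<bullet> (A *\<^sub>v v)}"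

definition mat_trace :: "real mat \<Rightarrow> real" where
  "mat_trace A = (\<Sum>i<dim_row A. A $$ (i, i))"

definition frob_inner :: "real mat \<Rightarrow> real mat \<Rightarrow> real" where
  "frob_inner A B = mat_trace (transpose_mat A * B)"

definition sign_vecs :: "nat \<Rightarrow> real vec set" where
  "sign_vecs m = {z \<in> carrier_vec m. \<forall>i<m. z $ i \<in> {-1, 1}}"

definition self_outer :: "real vec \<Rightarrow> real mat" where
  "self_outer z = mat (dim_vec z) (dim_vec z) (\<lambda>(i, j). z $ i * z $ j)"

definition unit_diag_psd :: "nat \<Rightarrow> real mat set" where
  "unit_diag_psd m = {Z \<in> psd_mats m. \<forall>i<m. Z $$ (i, i) = 1}"

definition is_unique_arg_min :: "('a \<Rightarrow> real) \<Rightarrow> ('a \<Rightarrow> bool) \<Rightarrow> 'a \<Rightarrow> bool" where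
  "is_unique_arg_min f P x \<longleftrightarrow> is_arg_min f P x \<and> (\<forall>y. is_arg_min f P y \<longrightarrow> y = x)"

end

theory Submission
  imports Defs
begin

text \<open>
  Among the feasible matrices, the concave term \<open>- lam * frob_inner Z Z\<close> is smallest exactly at
  those of rank one. Indeed, in a positive semidefinite matrix of size \<open>m\<close> with unit diagonal,
  every \<open>2 \<times> 2\<close> principal minor bounds an off-diagonal entry by 1 in absolute value, so the
  squared Frobenius norm is at most \<open>m\<^sup>2\<close>, with equality only if all entries are \<open>\<plusminus>1\<close>
  (\<open>frob_inner_self_le\<close>, \<open>frob_inner_self_max\<close>). Since \<open>self_outer zt\<close> attains this maximum
  and also minimizes the linear part, it minimizes the difference.

  Conversely, any minimizer must be optimal for both parts separately. Being optimal for the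
  quadratic part, it has entries \<open>\<plusminus>1\<close>, and then the \<open>3 \<times> 3\<close> principal minors force
  \<open>Z\<^sub>i\<^sub>j = Z\<^sub>i\<^sub>0 Z\<^sub>j\<^sub>0\<close>, so \<open>Z = w w\<^sup>T\<close> for its first column \<open>w\<close>, a sign vector with \<open>w\<^sub>0 = 1\<close>
  (\<open>unit_diag_psd_sign_entries_rank_one\<close>). Being optimal for the linear part, it gives \<open>w\<close>
  the same value of the quadratic form of \<open>R\<close> as \<open>zt\<close>, and the uniqueness of the discrete
  minimizer yields \<open>w = zt\<close>.
\<close>

lemma frob_inner_eq_sum:
  assumes "A \<in> carrier_mat m m" "B \<in> carrier_mat m m"
  shows "frob_inner A B = (\<Sum>i<m. \<Sum>j<m. A $$ (i, j) * B $$ (i, j))"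
proof -
  have "frob_inner A B = (\<Sum>j<m. \<Sum>i<m. A $$ (i, j) * B $$ (i, j))"
    using assms
    by (auto simp: frob_inner_def mat_trace_def scalar_prod_def atLeast0LessThan intro!: sum.cong)
  also have "\<dots> = (\<Sum>i<m. \<Sum>j<m. A $$ (i, j) * B $$ (i, j))"
    by (rule sum.swap)
  finally show ?thesis .
qed

lemma quadratic_form_eq_sum:
  fixes A :: "real mat"
  assumes "A \<in> carrier_mat m m" "v \<in> carrier_vec m"
  shows "v \<bullet> (A *\<^sub>v v) = (\<Sum>i<m. \<Sum>j<m. A $$ (i, j) * (v $ i * v $ j))"
  using assms
  by (auto simp: scalar_prod_def atLeast0LessThan sum_distrib_left algebra_simps intro!: sum.cong)

lemma frob_inner_self_outer:
  assumes "A \<in> carrier_mat m m" "v \<in> carrier_vec m"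
  shows "frob_inner A (self_outer v) = v \<bullet> (A *\<^sub>v v)"
proof -
  have "self_outer v \<in> carrier_mat m m"
    using assms by (auto simp: self_outer_def)
  then show ?thesis
    using assms by (simp add: frob_inner_eq_sum[of _ m] quadratic_form_eq_sum self_outer_def)
qed

lemma unit_diag_psdD:
  assumes "Z \<in> unit_diag_psd m"
  shows "Z \<in> carrier_mat m m"
    and "\<And>i. i < m \<Longrightarrow> Z $$ (i, i) = 1"
    and "\<And>i j. i < m \<Longrightarrow> j < m \<Longrightarrow> Z $$ (i, j) = Z $$ (j, i)"
    and "\<And>v. v \<in> carrier_vec m \<Longrightarrow> 0 \<le> v \<bullet> (Z *\<^sub>v v)"
proof -
  show carrier: "Z \<in> carrier_mat m m"
    using assms by (auto simp: unit_diag_psd_def psd_mats_def sym_mats_def)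
  show "Z $$ (i, j) = Z $$ (j, i)" if "i < m" "j < m" for i j
  proof -
    have "transpose_mat Z = Z"
      using assms by (auto simp: unit_diag_psd_def psd_mats_def sym_mats_def)
    then have "Z $$ (i, j) = transpose_mat Z $$ (i, j)" by simp
    then show ?thesis using carrier that by simp
  qed
qed (use assms in \<open>auto simp: unit_diag_psd_def psd_mats_def\<close>)

text \<open>
  Positivity of the quadratic form at \<open>a e\<^sub>i + b e\<^sub>j + c e\<^sub>k\<close>. The indices may coincide, so that
  the bounds below need no case distinction.
\<close>
lemma unit_diag_psd_three_indices:
  assumes Z: "Z \<in> unit_diag_psd m" and ijk: "i < m" "j < m" "k < m"
  shows "0 \<le> a\<^sup>2 + b\<^sup>2 + c\<^sup>2
    + 2 * (a * b * Z $$ (i, j) + a * c * Z $$ (i, k) + b * c * Z $$ (j, k))"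
proof -
  define v where "v = vec m (\<lambda>l. a * of_bool (l = i) + b * of_bool (l = j) + c * of_bool (l = k))"
  have pick: "(\<Sum>l<m. f l * v $ l) = a * f i + b * f j + c * f k" for f :: "nat \<Rightarrow> real"
  proof -
    have "(\<Sum>l<m. f l * v $ l) = (\<Sum>l<m. (if l = i then a * f l else 0)
        + (if l = j then b * f l else 0) + (if l = k then c * f l else 0))"
      by (intro sum.cong) (auto simp: v_def algebra_simps)
    also have "\<dots> = a * f i + b * f j + c * f k"
      using ijk by (simp add: sum.distrib)
    finally show ?thesis .
  qed
  have "v \<in> carrier_vec m" by (simp add: v_def)
  then have "0 \<le> v \<bullet> (Z *\<^sub>v v)" by (rule unit_diag_psdD(4)[OF Z])
  also have "\<dots> = (\<Sum>p<m. (\<Sum>q<m. Z $$ (p, q) * v $ q) * v $ p)"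
    using quadratic_form_eq_sum[OF unit_diag_psdD(1)[OF Z] \<open>v \<in> carrier_vec m\<close>]
    by (simp add: sum_distrib_left mult_ac)
  also have "\<dots> = a\<^sup>2 + b\<^sup>2 + c\<^sup>2
    + 2 * (a * b * Z $$ (i, j) + a * c * Z $$ (i, k) + b * c * Z $$ (j, k))"
    unfolding pick using ijk
    by (simp add: unit_diag_psdD(2)[OF Z] unit_diag_psdD(3)[OF Z, of j i]
        unit_diag_psdD(3)[OF Z, of k i] unit_diag_psdD(3)[OF Z, of k j] power2_eq_square
        algebra_simps)
  finally show ?thesis .
qed

lemma unit_diag_psd_entry_sq_le_1:
  assumes "Z \<in> unit_diag_psd m" "i < m" "j < m"
  shows "(Z $$ (i, j))\<^sup>2 \<le> 1"
proof -
  have "\<bar>Z $$ (i, j)\<bar> \<le> 1"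
    using unit_diag_psd_three_indices[OF assms assms(2), of 1 1 0]
      unit_diag_psd_three_indices[OF assms assms(2), of 1 "-1" 0]
    by simp
  then show ?thesis by (simp add: abs_square_le_1)
qed

lemma frob_inner_self_le:
  assumes "Z \<in> unit_diag_psd m"
  shows "frob_inner Z Z \<le> (real m)\<^sup>2"
proof -
  have "frob_inner Z Z \<le> (\<Sum>i<m. \<Sum>j<m. 1)"
    unfolding frob_inner_eq_sum[OF unit_diag_psdD(1)[OF assms] unit_diag_psdD(1)[OF assms]]
    using unit_diag_psd_entry_sq_le_1[OF assms]
    by (intro sum_mono) (simp add: power2_eq_square)
  then show ?thesis by (simp add: power2_eq_square)
qed

lemma frob_inner_self_max:
  assumes Z: "Z \<in> unit_diag_psd m" and max: "frob_inner Z Z = (real m)\<^sup>2"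
    and ij: "i < m" "j < m"
  shows "Z $$ (i, j) \<in> {-1, 1}"
proof -
  let ?defect = "\<lambda>(p, q). 1 - (Z $$ (p, q))\<^sup>2"
  have "(\<Sum>pq\<in>{..<m} \<times> {..<m}. ?defect pq) = (\<Sum>p<m. \<Sum>q<m. 1 - (Z $$ (p, q))\<^sup>2)"
    by (simp add: sum.cartesian_product)
  also have "\<dots> = (real m)\<^sup>2 - frob_inner Z Z"
    using frob_inner_eq_sum[OF unit_diag_psdD(1)[OF Z] unit_diag_psdD(1)[OF Z]]
    by (simp add: sum_subtractf power2_eq_square)
  finally have "(\<Sum>pq\<in>{..<m} \<times> {..<m}. ?defect pq) = 0"
    using max by simp
  moreover have "0 \<le> ?defect pq" if "pq \<in> {..<m} \<times> {..<m}" for pq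
    using that unit_diag_psd_entry_sq_le_1[OF Z] by auto
  ultimately have "\<forall>pq\<in>{..<m} \<times> {..<m}. ?defect pq = 0"
    by (subst (asm) sum_nonneg_eq_0_iff) auto
  then have "(Z $$ (i, j))\<^sup>2 = 1" using ij by auto
  then show ?thesis by (auto simp: power2_eq_1_iff)
qed

text \<open>
  If \<open>Z\<^sub>i\<^sub>j Z\<^sub>i\<^sub>0 Z\<^sub>j\<^sub>0 = -1\<close>, then the quadratic form takes the value \<open>3 - 2 - 2 - 2 = -3\<close> at
  \<open>e\<^sub>0 - Z\<^sub>i\<^sub>0 e\<^sub>i - Z\<^sub>j\<^sub>0 e\<^sub>j\<close>.
\<close>
lemma unit_diag_psd_sign_entries_rank_one:
  assumes Z: "Z \<in> unit_diag_psd m"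
    and sign: "\<And>i j. i < m \<Longrightarrow> j < m \<Longrightarrow> Z $$ (i, j) \<in> {-1, 1}"
  shows "Z = self_outer (vec m (\<lambda>i. Z $$ (i, 0)))"
proof (rule eq_matI)
  fix i j
  assume "i < dim_row (self_outer (vec m (\<lambda>i. Z $$ (i, 0))))"
    and "j < dim_col (self_outer (vec m (\<lambda>i. Z $$ (i, 0))))"
  then have ij: "i < m" "j < m" by (auto simp: self_outer_def)
  then have 0: "0 < m" by simp
  have "Z $$ (i, j) = Z $$ (i, 0) * Z $$ (j, 0)"
    using unit_diag_psd_three_indices[OF Z ij 0, of "- Z $$ (i, 0)" "- Z $$ (j, 0)" 1]
      sign[OF ij] sign[OF ij(1) 0] sign[OF ij(2) 0]
    by auto
  then show "Z $$ (i, j) = self_outer (vec m (\<lambda>i. Z $$ (i, 0))) $$ (i, j)"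
    using ij by (simp add: self_outer_def)
qed (use unit_diag_psdD(1)[OF Z] in \<open>auto simp: self_outer_def\<close>)

lemma frob_inner_self_outer_self:
  assumes "z \<in> sign_vecs m"
  shows "frob_inner (self_outer z) (self_outer z) = (real m)\<^sup>2"
proof -
  have dim: "dim_vec z = m" using assms by (auto simp: sign_vecs_def)
  then have carrier: "self_outer z \<in> carrier_mat m m" by (simp add: self_outer_def)
  have "frob_inner (self_outer z) (self_outer z) = (\<Sum>i<m. \<Sum>j<m. 1)"
    unfolding frob_inner_eq_sum[OF carrier carrier]
  proof (intro sum.cong refl)
    fix i j assume "i \<in> {..<m}" "j \<in> {..<m}"
    moreover from this have "z $ i \<in> {-1, 1}" "z $ j \<in> {-1, 1}"
      using assms by (auto simp: sign_vecs_def)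
    ultimately show "self_outer z $$ (i, j) * self_outer z $$ (i, j) = 1"
      using dim by (auto simp: self_outer_def)
  qed
  then show ?thesis by (simp add: power2_eq_square)
qed

theorem proposition1:
  fixes n :: nat and R :: "real mat" and zt :: "real vec"
  assumes "n \<ge> 1"
    and "R \<in> sym_mats (n + 1)"
    and "zt \<in> sign_vecs (n + 1)"
    and "zt $ 0 = 1"
    and "is_unique_arg_min (\<lambda>z. z \<bullet> (R *\<^sub>v z)) (\<lambda>z. z \<in> sign_vecs (n + 1) \<and> z $ 0 = 1) zt"
    and "is_arg_min (frob_inner R) (\<lambda>Z. Z \<in> unit_diag_psd (n + 1)) (self_outer zt)"
  shows "\<forall>lam > (0::real).
      is_unique_arg_min (\<lambda>Z. frob_inner R Z - lam * frob_inner Z Z)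
        (\<lambda>Z. Z \<in> unit_diag_psd (n + 1)) (self_outer zt) \<and>
      (\<forall>Zs. is_arg_min (\<lambda>Z. frob_inner R Z - lam * frob_inner Z Z)
          (\<lambda>Z. Z \<in> unit_diag_psd (n + 1)) Zs \<longrightarrow>
        zt = vCons 1 (vec n (\<lambda>i. Zs $$ (i + 1, 0))))"
proof (intro allI impI)
  fix lam :: real
  assume lam: "lam > 0"
  let ?m = "n + 1"
  let ?Zt = "self_outer zt"
  let ?f = "\<lambda>Z. frob_inner R Z - lam * frob_inner Z Z"
  have zt: "zt \<in> carrier_vec ?m" using assms(3) by (simp add: sign_vecs_def)
  have R: "R \<in> carrier_mat ?m ?m" using assms(2) by (simp add: sym_mats_def)
  have Zt: "?Zt \<in> unit_diag_psd ?m" using assms(6) by (simp add: is_arg_min_def)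
  have lin: "frob_inner R ?Zt \<le> frob_inner R Z" if "Z \<in> unit_diag_psd ?m" for Z
    using assms(6) that by (auto simp: is_arg_min_def not_less)
  have quad: "frob_inner Z Z \<le> frob_inner ?Zt ?Zt" if "Z \<in> unit_diag_psd ?m" for Z
    using frob_inner_self_le[OF that] frob_inner_self_outer_self[OF assms(3)] by simp
  have minimizer: "is_arg_min ?f (\<lambda>Z. Z \<in> unit_diag_psd ?m) ?Zt"
    unfolding is_arg_min_def not_ex
  proof (intro conjI allI notI Zt)
    fix Z assume "Z \<in> unit_diag_psd ?m \<and> ?f Z < ?f ?Zt"
    moreover from this have "lam * frob_inner Z Z \<le> lam * frob_inner ?Zt ?Zt"
      using quad lam by simp
    ultimately show False using lin[of Z] by simp
  qed
  have unique: "Z = ?Zt" if "is_arg_min ?f (\<lambda>Z. Z \<in> unit_diag_psd ?m) Z" for Z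
  proof -
    have Z: "Z \<in> unit_diag_psd ?m" and le: "?f Z \<le> ?f ?Zt"
      using that Zt by (auto simp: is_arg_min_def not_less)
    have "lam * frob_inner Z Z \<le> lam * frob_inner ?Zt ?Zt"
      using quad[OF Z] lam by simp
    \<comment> \<open>Neither the linear nor the concave part can be smaller at \<open>Z\<close> than at \<open>?Zt\<close>, so
      neither can be larger without making the sum larger.\<close>
    then have R_eq: "frob_inner R Z = frob_inner R ?Zt"
      and "lam * frob_inner Z Z = lam * frob_inner ?Zt ?Zt"
      using lin[OF Z] le by linarith+
    then have max: "frob_inner Z Z = (real ?m)\<^sup>2"
      using lam frob_inner_self_outer_self[OF assms(3)] by simp
    note sign = frob_inner_self_max[OF Z max]
    define w where "w = vec ?m (\<lambda>i. Z $$ (i, 0))"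
    have Zw: "Z = self_outer w"
      using unit_diag_psd_sign_entries_rank_one[OF Z sign] by (simp add: w_def)
    have w: "w \<in> carrier_vec ?m" by (simp add: w_def)
    have "w \<in> sign_vecs ?m" "w $ 0 = 1"
      using sign unit_diag_psdD(2)[OF Z, of 0] by (auto simp: w_def sign_vecs_def)
    moreover have "w \<bullet> (R *\<^sub>v w) = zt \<bullet> (R *\<^sub>v zt)"
      using R_eq frob_inner_self_outer[OF R w] frob_inner_self_outer[OF R zt] Zw by simp
    ultimately have "is_arg_min (\<lambda>z. z \<bullet> (R *\<^sub>v z)) (\<lambda>z. z \<in> sign_vecs ?m \<and> z $ 0 = 1) w"
      using assms(5) by (simp add: is_unique_arg_min_def is_arg_min_def)
    then have "w = zt" using assms(5) by (auto simp: is_unique_arg_min_def)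
    with Zw show ?thesis by simp
  qed
  have "zt = vCons 1 (vec n (\<lambda>i. ?Zt $$ (i + 1, 0)))"
  proof (rule eq_vecI)
    fix i assume "i < dim_vec (vCons 1 (vec n (\<lambda>i. ?Zt $$ (i + 1, 0))))"
    then show "zt $ i = vCons 1 (vec n (\<lambda>i. ?Zt $$ (i + 1, 0))) $ i"
      using zt assms(4) by (cases i) (auto simp: self_outer_def)
  qed (use zt in simp)
  then show "is_unique_arg_min ?f (\<lambda>Z. Z \<in> unit_diag_psd ?m) ?Zt \<and>
      (\<forall>Zs. is_arg_min ?f (\<lambda>Z. Z \<in> unit_diag_psd ?m) Zs \<longrightarrow>
        zt = vCons 1 (vec n (\<lambda>i. Zs $$ (i + 1, 0))))"
    using minimizer unique unfolding is_unique_arg_min_def by blast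
qed

end
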